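(* Let $s = s(n)$ be a positive-integer-valued function of $n$. Then $\lambda_{s}(n;n) = \Omega(n^{2-o(1)})$ if and only if $s(n) = \Omega(n^{1-o(1)})$.
   Context: All sequences are finite. A Davenport-Schinzel sequence of order $s$ is a sequence with no adjacent same letters that avoids alternations of length $s+2$, i.e. that has no (not necessarily contiguous) subsequence of the form $a\,b\,a\,b\dots$ of length $s+2$ with $a \neq b$. A $DS(n,s)$ sequence is a Davenport-Schinzel sequence of order $s$ with $n$ distinct letters. A block is a contiguous subsequence of distinct letters (blocks may be empty). $\lambda_s(n;m)$ denotes the maximum possible length of a $DS(n,s)$ sequence that can be partitioned into $m$ blocks (i.e. written as a concatenation of $m$ blocks). Asymptotics are as $n \to \infty$; $f(n) = \Omega(n^{k-o(1)})$ means that for every $\varepsilon > 0$ one has $f(n) \geq n^{k-\varepsilon}$ for all sufficiently large $n$. *)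

theory Defs
  imports Complex_Main "HOL-Library.Sublist"
begin

definition alternation :: "'a \<Rightarrow> 'a \<Rightarrow> nat \<Rightarrow> 'a list" where
  "alternation a b l = map (\<lambda>i. if even i then a else b) [0..<l]"

definition davenport_schinzel :: "nat \<Rightarrow> 'a list \<Rightarrow> bool" where
  "davenport_schinzel s xs \<longleftrightarrow>
     distinct_adj xs \<and> (\<forall>a b. a \<noteq> b \<longrightarrow> \<not> subseq (alternation a b (s + 2)) xs)"

definition DS :: "nat \<Rightarrow> nat \<Rightarrow> 'a list \<Rightarrow> bool" where
  "DS n s xs \<longleftrightarrow> davenport_schinzel s xs \<and> card (set xs) = n"

text \<open>Blocks may be empty, so this also holds for every larger number of blocks.\<close>

definition partitionable_into_blocks :: "nat \<Rightarrow> 'a list \<Rightarrow> bool" where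
  "partitionable_into_blocks m xs \<longleftrightarrow>
     (\<exists>bs. length bs = m \<and> concat bs = xs \<and> (\<forall>b\<in>set bs. distinct b))"

text \<open>The letters are natural numbers; only the number of distinct letters matters.
  The set of lengths below is bounded by \<open>n * m\<close>, and for \<open>s \<ge> 1\<close> it is empty
  only if \<open>m = 0 < n\<close> (a single block of \<open>n\<close> letters has no alternation of length 3).\<close>

definition ds_lambda :: "nat \<Rightarrow> nat \<Rightarrow> nat \<Rightarrow> nat" where
  "ds_lambda s n m =
     Max {length xs | xs :: nat list. DS n s xs \<and> partitionable_into_blocks m xs}"

text \<open>This is the relation written \<open>f(n) = \<Omega>(n^(k - o(1)))\<close>.\<close>

definition Omega_power_minus_o1 :: "real \<Rightarrow> (nat \<Rightarrow> real) \<Rightarrow> bool" where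
  "Omega_power_minus_o1 k f \<longleftrightarrow>
     (\<forall>\<epsilon>>0. \<forall>\<^sub>F n in sequentially. f n \<ge> real n powr (k - \<epsilon>))"

end

theory Submission
  imports Defs "HOL-Analysis.Convex"
begin

text \<open>
  Both directions are consequences of explicit bounds on \<open>\<lambda>\<^sub>s(n;n)\<close> for \<open>s \<ge> 1\<close>:
  \<open>n \<cdot> min n s / 4 \<le> \<lambda>\<^sub>s(n;n)\<close> and \<open>\<lambda>\<^sub>s(n;n)\<^sup>2 \<le> 3 n\<^sup>3 s\<close>. Constant
  factors, and constant multiples of \<open>\<epsilon>\<close> in the exponent, disappear in the \<open>o(1)\<close>.

  The upper bound (\<open>ds_lambda_squared_le\<close>) counts pairs of letters that meet in a block. If two
  letters \<open>a \<noteq> b\<close> share \<open>c\<close> blocks, then one of them can be picked from each of these blocks,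
  in turn, which gives an alternation of length \<open>c\<close>; hence \<open>c \<le> s + 1\<close>. On the other hand the
  squares of the block lengths sum to the number of ways to choose a block and an ordered pair of
  its letters, and by the Cauchy-Schwarz inequality this is at least the squared length
  of the sequence divided by the number of blocks.

  The lower bound (\<open>ds_lambda_ge_min\<close>) uses that two letters alternate at most twice per block.
  So \<open>j\<close> copies of \<open>0, \<dots>, j - 1\<close> in a row are a sequence of length \<open>j\<^sup>2\<close> with \<open>j\<close> letters and
  \<open>j\<close> blocks, whose order is at most \<open>s\<close> if \<open>2 j \<le> s + 1\<close>. Sequences over disjoint alphabets can be
  concatenated without any harm, since an alternation of length at least \<open>3\<close> cannot use letters
  from two of them. Putting \<open>n div j\<close> such sequences next to each other uses at least
  half of the \<open>n\<close> letters and \<open>n\<close> blocks and gives a length of at least \<open>n j / 2\<close>, which for \<open>s \<ge> n\<^bsup>1 - o(1)\<^esup>\<close> is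
  at least \<open>n\<^bsup>2 - o(1)\<^esup>\<close> if \<open>j\<close> is taken to be about half of \<open>min n s\<close>.
\<close>

section \<open>Alternations\<close>

lemma length_alternation [simp]: "length (alternation a b l) = l"
  by (simp add: alternation_def)

lemma alternation_nth: "i < l \<Longrightarrow> alternation a b l ! i = (if even i then a else b)"
  by (simp add: alternation_def)

lemma alternation_Suc: "alternation a b (Suc l) = a # alternation b a l"
  by (rule nth_equalityI) (auto simp: alternation_nth nth_Cons split: nat.split)

lemma set_alternation: "set (alternation a b l) \<subseteq> {a, b}"
  by (auto simp: alternation_def)

lemma map_alternation: "map f (alternation a b l) = alternation (f a) (f b) l"
  by (simp add: alternation_def)

lemma alternation_letters:
  assumes "subseq (alternation a b l) xs" "2 \<le> l"
  shows "a \<in> set xs" "b \<in> set xs"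
proof -
  have "alternation a b l ! 0 = a" "alternation a b l ! 1 = b"
    using assms(2) by (simp_all add: alternation_nth)
  then have "a \<in> set (alternation a b l)" "b \<in> set (alternation a b l)"
    using assms(2) nth_mem[of 0 "alternation a b l"] nth_mem[of 1 "alternation a b l"] by simp_all
  then show "a \<in> set xs" "b \<in> set xs"
    using list_emb_set[OF assms(1)] by blast+
qed

lemma subseq_alternation_mono:
  assumes "k \<le> l" shows "subseq (alternation a b k) (alternation a b l)"
proof -
  have "alternation a b k = take k (alternation a b l)"
    by (rule nth_equalityI) (use assms in \<open>auto simp: alternation_nth\<close>)
  then show ?thesis
    by (metis prefix_imp_subseq take_is_prefix)
qed

definition blocks_with_both :: "'a \<Rightarrow> 'a \<Rightarrow> 'a list list \<Rightarrow> nat" where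
  "blocks_with_both a b bs = length (filter (\<lambda>B. a \<in> set B \<and> b \<in> set B) bs)"

text \<open>
  Each block that contains both letters supplies whichever of them comes next in the
  alternation, in whatever order the block lists them. The letters swap roles from one such block to
  the next, so the induction must leave them arbitrary.
\<close>

lemma alternation_of_blocks_with_both:
  "subseq (alternation a b (blocks_with_both a b bs)) (concat bs)"
proof (induction bs arbitrary: a b)
  case Nil
  then show ?case by (simp add: blocks_with_both_def alternation_def)
next
  case (Cons B bs)
  show ?case
  proof (cases "a \<in> set B \<and> b \<in> set B")
    case True
    have sym: "blocks_with_both a b bs = blocks_with_both b a bs"
      by (simp add: blocks_with_both_def conj_commute)
    have "subseq ([a] @ alternation b a (blocks_with_both b a bs)) (B @ concat bs)"
      using True by (intro list_emb_append_mono Cons.IH) (simp add: subseq_singleton_left)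
    moreover have "blocks_with_both a b (B # bs) = Suc (blocks_with_both b a bs)"
      using True sym by (simp add: blocks_with_both_def)
    ultimately show ?thesis
      by (simp add: alternation_Suc)
  next
    case False
    then show ?thesis
      using Cons.IH[of a b] by (auto simp: blocks_with_both_def subseq_drop_many)
  qed
qed

text \<open>
  A block contributes each of the two letters at most once.
\<close>

lemma length_filter_pair_concat:
  assumes "\<forall>B\<in>set bs. distinct B"
  shows "length (filter (\<lambda>x. x \<in> {a, b}) (concat bs)) \<le> 2 * length bs"
  using assms
proof (induction bs)
  case Nil
  then show ?case by simp
next
  case (Cons B bs)
  have "length (filter (\<lambda>x. x \<in> {a, b}) B) = card ({a, b} \<inter> set B)"
    using Cons.prems distinct_length_filter[of B "\<lambda>x. x \<in> {a, b}"]
    by (simp only: Collect_mem_eq) simp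
  also have "\<dots> \<le> card {a, b}"
    by (intro card_mono) auto
  also have "\<dots> \<le> 2"
    by (cases "a = b") auto
  finally show ?case
    using Cons by simp
qed

lemma alternation_le_twice_blocks:
  assumes "partitionable_into_blocks j xs" "subseq (alternation a b l) xs"
  shows "l \<le> 2 * j"
proof -
  obtain bs where bs: "length bs = j" "concat bs = xs" "\<forall>B\<in>set bs. distinct B"
    using assms(1) by (auto simp: partitionable_into_blocks_def)
  have "filter (\<lambda>x. x \<in> {a, b}) (alternation a b l) = alternation a b l"
    using set_alternation[of a b l] by (auto intro!: filter_True)
  then have "subseq (alternation a b l) (filter (\<lambda>x. x \<in> {a, b}) xs)"
    using subseq_filter[OF assms(2), of "\<lambda>x. x \<in> {a, b}"] by metis
  then have "l \<le> length (filter (\<lambda>x. x \<in> {a, b}) (concat bs))"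
    using list_emb_length bs(2) by fastforce
  also have "\<dots> \<le> 2 * j"
    using length_filter_pair_concat[OF bs(3)] bs(1) by simp
  finally show ?thesis .
qed

text \<open>
  With few enough blocks, only adjacent repetitions can spoil a Davenport-Schinzel sequence.
\<close>

lemma DS_of_few_blocks:
  assumes "partitionable_into_blocks j xs" "distinct_adj xs" "2 * j \<le> s + 1"
  shows "DS (card (set xs)) s xs"
proof -
  have "\<not> subseq (alternation a b (s + 2)) xs" for a b
    using alternation_le_twice_blocks[OF assms(1), of a b "s + 2"] assms(3) by linarith
  then show ?thesis
    using assms(2) by (simp add: DS_def davenport_schinzel_def)
qed

section \<open>Lengths of blocked sequences\<close>

lemma length_le_letters_times_blocks:
  assumes "partitionable_into_blocks m xs"
  shows "length xs \<le> card (set xs) * m"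
proof -
  obtain bs where bs: "length bs = m" "concat bs = xs" "\<forall>B\<in>set bs. distinct B"
    using assms by (auto simp: partitionable_into_blocks_def)
  have "length B \<le> card (set xs)" if "B \<in> set bs" for B
  proof -
    have "length B = card (set B)"
      using bs(3) that by (simp add: distinct_card)
    also have "\<dots> \<le> card (set xs)"
      using that bs(2) by (intro card_mono) auto
    finally show ?thesis .
  qed
  then have "sum_list (map length bs) \<le> (\<Sum>B\<leftarrow>bs. card (set xs))"
    by (intro sum_list_mono) auto
  then show ?thesis
    using bs(1) by (simp add: bs(2)[symmetric] length_concat sum_list_triv mult.commute)
qed

text \<open>
  Double counting of the triples of a block and two of its letters, equal letters included.
\<close>

lemma sum_blocks_with_both:
  assumes "finite A" "\<forall>B\<in>set bs. set B \<subseteq> A"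
  shows "(\<Sum>B\<leftarrow>bs. (card (set B))\<^sup>2) = (\<Sum>a\<in>A. \<Sum>b\<in>A. blocks_with_both a b bs)"
  using assms(2)
proof (induction bs)
  case Nil
  then show ?case by (simp add: blocks_with_both_def)
next
  case (Cons B bs)
  have "(card (set B))\<^sup>2 = (\<Sum>a\<in>A. of_bool (a \<in> set B)) * (\<Sum>b\<in>A. of_bool (b \<in> set B))"
    using Cons.prems assms(1) by (simp add: power2_eq_square Int_absorb1 Int_def[symmetric] Int_commute)
  also have "\<dots> = (\<Sum>a\<in>A. \<Sum>b\<in>A. of_bool (a \<in> set B \<and> b \<in> set B))"
    by (simp only: sum_product of_bool_conj)
  finally have square: "(card (set B))\<^sup>2 = (\<Sum>a\<in>A. \<Sum>b\<in>A. of_bool (a \<in> set B \<and> b \<in> set B))" .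
  have step: "blocks_with_both a b (B # bs)
      = of_bool (a \<in> set B \<and> b \<in> set B) + blocks_with_both a b bs" for a b
    by (simp add: blocks_with_both_def)
  show ?case
    using Cons square by (simp add: step sum.distrib del: of_bool_conj)
qed

lemma sum_list_squared_le:
  "(sum_list ns)\<^sup>2 \<le> length ns * (\<Sum>n\<leftarrow>ns. n\<^sup>2)" for ns :: "nat list"
proof -
  have "(\<Sum>i<length ns. real (ns ! i))\<^sup>2 \<le> (\<Sum>i<length ns. (real (ns ! i))\<^sup>2) * card {..<length ns}"
    by (rule sum_squared_le_sum_of_squares)
  then have "real ((\<Sum>i<length ns. ns ! i)\<^sup>2) \<le> real (length ns * (\<Sum>i<length ns. (ns ! i)\<^sup>2))"
    by (simp add: mult.commute)
  then have "(\<Sum>i<length ns. ns ! i)\<^sup>2 \<le> length ns * (\<Sum>i<length ns. (ns ! i)\<^sup>2)"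
    by (simp only: of_nat_le_iff)
  then show ?thesis
    by (simp add: sum_list_sum_nth atLeast0LessThan)
qed

lemma blocks_with_both_le:
  assumes "davenport_schinzel s (concat bs)" "a \<noteq> b"
  shows "blocks_with_both a b bs \<le> s + 1"
proof (rule ccontr)
  assume "\<not> ?thesis"
  then have "s + 2 \<le> blocks_with_both a b bs"
    by simp
  then have "subseq (alternation a b (s + 2)) (concat bs)"
    using alternation_of_blocks_with_both subseq_alternation_mono subseq_order.trans by metis
  then show False
    using assms by (auto simp: davenport_schinzel_def)
qed

text \<open>
  The term \<open>n * m\<close> comes from the pairs of equal letters, which may meet in all \<open>m\<close> blocks;
  the term \<open>n\<^sup>2 * (s + 1)\<close> comes from the pairs of distinct letters.
\<close>

lemma DS_length_squared_le:
  assumes "DS n s xs" "partitionable_into_blocks m xs"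
  shows "(length xs)\<^sup>2 \<le> m * (n * m + n\<^sup>2 * (s + 1))"
proof -
  obtain bs where bs: "length bs = m" "concat bs = xs" "\<forall>B\<in>set bs. distinct B"
    using assms(2) by (auto simp: partitionable_into_blocks_def)
  let ?A = "set xs"
  have card: "card ?A = n"
    using assms(1) by (simp add: DS_def)
  have pair: "blocks_with_both a b bs \<le> (if a = b then m else 0) + (s + 1)" for a b
  proof (cases "a = b")
    case True
    have "blocks_with_both a b bs \<le> m"
      by (simp add: blocks_with_both_def flip: bs(1))
    then show ?thesis
      using True by simp
  next
    case False
    then show ?thesis
      using blocks_with_both_le[of s bs a b] assms(1) bs(2) by (simp add: DS_def)
  qed
  have "(\<Sum>B\<leftarrow>bs. (length B)\<^sup>2) = (\<Sum>B\<leftarrow>bs. (card (set B))\<^sup>2)"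
    using bs(3) by (intro arg_cong[of _ _ sum_list] map_cong) (auto simp: distinct_card)
  also have "\<dots> = (\<Sum>a\<in>?A. \<Sum>b\<in>?A. blocks_with_both a b bs)"
    using bs(2) by (intro sum_blocks_with_both) auto
  also have "\<dots> \<le> (\<Sum>a\<in>?A. \<Sum>b\<in>?A. (if a = b then m else 0) + (s + 1))"
    by (intro sum_mono pair)
  also have "\<dots> = (\<Sum>a\<in>?A. m + n * (s + 1))"
    by (intro sum.cong refl, simp only: sum.distrib) (simp add: card)
  also have "\<dots> = n * m + n\<^sup>2 * (s + 1)"
    by (simp add: card power2_eq_square algebra_simps)
  finally have "(\<Sum>B\<leftarrow>bs. (length B)\<^sup>2) \<le> n * m + n\<^sup>2 * (s + 1)" .
  then have "m * (\<Sum>B\<leftarrow>bs. (length B)\<^sup>2) \<le> m * (n * m + n\<^sup>2 * (s + 1))"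
    by (rule mult_le_mono2)
  moreover have "(length xs)\<^sup>2 \<le> m * (\<Sum>B\<leftarrow>bs. (length B)\<^sup>2)"
    using sum_list_squared_le[of "map length bs"] bs(1)
    by (simp add: length_concat o_def flip: bs(2))
  ultimately show ?thesis
    by (rule order.trans[rotated])
qed

section \<open>The extremal function\<close>

text \<open>
  Finiteness makes the maximum in the definition of \<open>\<lambda>\<^sub>s(n;m)\<close> an upper bound for the lengths.
\<close>

lemma finite_DS_lengths:
  "finite {length xs | xs :: nat list. DS n s xs \<and> partitionable_into_blocks m xs}"
proof (rule finite_subset)
  show "{length xs | xs :: nat list. DS n s xs \<and> partitionable_into_blocks m xs} \<subseteq> {..n * m}"
    using length_le_letters_times_blocks unfolding DS_def by blast
qed simp

lemma ds_lambda_ge: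
  fixes xs :: "nat list"
  assumes "DS n s xs" "partitionable_into_blocks m xs"
  shows "length xs \<le> ds_lambda s n m"
  unfolding ds_lambda_def by (rule Max_ge[OF finite_DS_lengths]) (use assms in blast)

text \<open>
  The maximum is over a nonempty set, because a single block of \<open>n\<close> letters, padded with empty
  blocks, is admissible for every order \<open>s \<ge> 1\<close>.
\<close>

lemma ds_lambda_attained:
  assumes "s \<ge> 1" "m > 0 \<or> n = 0"
  obtains xs :: "nat list" where
    "DS n s xs" "partitionable_into_blocks m xs" "length xs = ds_lambda s n m"
proof -
  have "partitionable_into_blocks 1 [0..<n]"
    unfolding partitionable_into_blocks_def by (rule exI[of _ "[[0..<n]]"]) simp
  moreover have "distinct_adj [0..<n]"
    by (simp add: distinct_adj_conv_nth)
  ultimately have "DS n s [0..<n]"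
    using DS_of_few_blocks[of 1 "[0..<n]" s] assms(1) by simp
  moreover have "partitionable_into_blocks m [0..<n]"
  proof (cases m)
    case 0
    then show ?thesis
      using assms(2) by (simp add: partitionable_into_blocks_def)
  next
    case (Suc k)
    then show ?thesis
      unfolding partitionable_into_blocks_def by (intro exI[of _ "[0..<n] # replicate k []"]) simp
  qed
  ultimately have "ds_lambda s n m \<in>
      {length xs | xs :: nat list. DS n s xs \<and> partitionable_into_blocks m xs}"
    unfolding ds_lambda_def by (intro Max_in finite_DS_lengths) blast
  then show thesis
    using that by force
qed

lemma ds_lambda_squared_le:
  assumes "s \<ge> 1"
  shows "(ds_lambda s n n)\<^sup>2 \<le> 3 * n ^ 3 * s"
proof -
  obtain xs :: "nat list" where xs:
    "DS n s xs" "partitionable_into_blocks n xs" "length xs = ds_lambda s n n"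
    using ds_lambda_attained[OF assms, of n n] by auto
  have "(ds_lambda s n n)\<^sup>2 \<le> n * (n * n + n\<^sup>2 * (s + 1))"
    using DS_length_squared_le[OF xs(1,2)] xs(3) by simp
  also have "\<dots> = n ^ 3 * (s + 2)"
    by (simp add: algebra_simps power2_eq_square power3_eq_cube)
  also have "\<dots> \<le> n ^ 3 * (3 * s)"
    using assms by (intro mult_left_mono) auto
  finally show ?thesis
    by (simp add: mult_ac)
qed

section \<open>Superadditivity\<close>

lemma DS_map:
  assumes "DS n s xs" "inj f"
  shows "DS n s (map f xs)"
proof -
  have "\<not> subseq (alternation a b (s + 2)) (map f xs)" if "a \<noteq> b" for a b
  proof
    assume sub: "subseq (alternation a b (s + 2)) (map f xs)"
    then have "a \<in> range f" "b \<in> range f"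
      using alternation_letters[OF sub] by auto
    then have "inv f a \<noteq> inv f b"
      using that by (metis f_inv_into_f)
    moreover have "subseq (alternation (inv f a) (inv f b) (s + 2)) xs"
      using subseq_map[OF sub, of "inv f"] assms(2) by (simp add: map_alternation)
    ultimately show False
      using assms(1) by (auto simp: DS_def davenport_schinzel_def)
  qed
  then show ?thesis
    using assms(1) inj_on_subset[OF assms(2) subset_UNIV]
    by (simp add: DS_def davenport_schinzel_def distinct_adj_mapI card_image)
qed

lemma partitionable_map:
  assumes "partitionable_into_blocks m xs" "inj f"
  shows "partitionable_into_blocks m (map f xs)"
proof -
  obtain bs where bs: "length bs = m" "concat bs = xs" "\<forall>B\<in>set bs. distinct B"
    using assms(1) by (auto simp: partitionable_into_blocks_def)
  have "concat (map (map f) bs) = map f xs"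
    unfolding bs(2)[symmetric] by (rule map_concat[symmetric])
  moreover have "\<forall>B\<in>set (map (map f) bs). distinct B"
    using bs(3) inj_on_subset[OF assms(2) subset_UNIV] by (simp add: distinct_map)
  moreover have "length (map (map f) bs) = m"
    using bs(1) by simp
  ultimately show ?thesis
    unfolding partitionable_into_blocks_def by blast
qed

lemma partitionable_append:
  assumes "partitionable_into_blocks m xs" "partitionable_into_blocks m' ys"
  shows "partitionable_into_blocks (m + m') (xs @ ys)"
proof -
  obtain bs bs' where
    "length bs = m" "concat bs = xs" "\<forall>B\<in>set bs. distinct B"
    "length bs' = m'" "concat bs' = ys" "\<forall>B\<in>set bs'. distinct B"
    using assms unfolding partitionable_into_blocks_def by blast
  then show ?thesis
    unfolding partitionable_into_blocks_def by (intro exI[of _ "bs @ bs'"]) (simp add: ball_Un)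
qed

text \<open>
  If the alternation were cut into two nonempty parts, then one of its letters would occur on
  both sides of the cut: \<open>a\<close> is repeated at distance two, so it does when the first part has length one,
  and otherwise the first part has both letters already. The bound \<open>3 \<le> l\<close> is sharp, as \<open>a b\<close>
  can be split.
\<close>

lemma alternation_in_disjoint_append:
  assumes "subseq (alternation a b l) (xs @ ys)" "set xs \<inter> set ys = {}" "3 \<le> l"
  shows "subseq (alternation a b l) xs \<or> subseq (alternation a b l) ys"
proof -
  obtain us vs where w: "alternation a b l = us @ vs" "subseq us xs" "subseq vs ys"
    using assms(1) by (auto elim: subseq_appendE)
  have len: "length us + length vs = l"
    using w(1) by (metis length_alternation length_append)
  have subsets: "set us \<subseteq> set xs" "set vs \<subseteq> set ys"
    using list_emb_set[OF w(2)] list_emb_set[OF w(3)] by blast+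
  have us: "(if even i then a else b) \<in> set xs" if "i < length us" for i
  proof -
    have "us ! i = (if even i then a else b)"
      using that len alternation_nth[of i l a b] by (simp add: w(1) nth_append)
    then show ?thesis
      using subsets(1) nth_mem[OF that] by auto
  qed
  have vs: "(if even i then a else b) \<in> set ys" if "length us \<le> i" "i < l" for i
  proof -
    have "vs ! (i - length us) = (if even i then a else b)"
      using that len alternation_nth[of i l a b] by (simp add: w(1) nth_append)
    moreover have "vs ! (i - length us) \<in> set vs"
      using that len by (intro nth_mem) linarith
    ultimately show ?thesis
      using subsets(2) by auto
  qed
  consider "us = []" | "vs = []" | "length us = 1" | "2 \<le> length us" "length us < l"
    using len by (cases us; cases vs; fastforce simp: Suc_le_eq)
  then show ?thesis
  proof cases
    case 3
    then have "a \<in> set xs" "a \<in> set ys"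
      using us[of 0] vs[of 2] assms(3) by simp_all
    then show ?thesis
      using assms(2) by auto
  next
    case 4
    then have "a \<in> set xs" "b \<in> set xs" "a \<in> set ys \<or> b \<in> set ys"
      using us[of 0] us[of 1] vs[of "length us"] by (fastforce split: if_splits)+
    then show ?thesis
      using assms(2) by auto
  qed (use w in auto)
qed

lemma DS_append:
  assumes "DS n s xs" "DS n' s ys" "set xs \<inter> set ys = {}" "s \<ge> 1"
  shows "DS (n + n') s (xs @ ys)"
proof -
  have "distinct_adj (xs @ ys)"
    using assms(1-3) by (auto simp: DS_def davenport_schinzel_def distinct_adj_append_iff)
      (metis IntI empty_iff last_in_set list.set_sel(1))
  moreover have "\<not> subseq (alternation a b (s + 2)) (xs @ ys)" if "a \<noteq> b" for a b
    using alternation_in_disjoint_append[of a b "s + 2" xs ys] assms that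
    by (auto simp: DS_def davenport_schinzel_def)
  ultimately show ?thesis
    using assms(1-3) by (simp add: DS_def davenport_schinzel_def card_Un_disjoint)
qed

text \<open>
  The two optimal sequences are concatenated, after the letters of the second one are shifted
  past those of the first.
\<close>

lemma ds_lambda_superadditive:
  assumes "s \<ge> 1" "m > 0 \<or> n = 0" "m' > 0 \<or> n' = 0"
  shows "ds_lambda s n m + ds_lambda s n' m' \<le> ds_lambda s (n + n') (m + m')"
proof -
  obtain xs :: "nat list" where xs:
    "DS n s xs" "partitionable_into_blocks m xs" "length xs = ds_lambda s n m"
    using ds_lambda_attained[OF assms(1,2)] .
  obtain ys :: "nat list" where ys:
    "DS n' s ys" "partitionable_into_blocks m' ys" "length ys = ds_lambda s n' m'"
    using ds_lambda_attained[OF assms(1,3)] .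
  define f where "f = (+) (Suc (Max (set xs)))"
  have inj: "inj f"
    by (simp add: f_def)
  have "x < f y" if "x \<in> set xs" for x y
    using Max_ge[OF finite_set that] by (simp add: f_def)
  then have "x \<noteq> f y" if "x \<in> set xs" for x y
    using that by (metis less_irrefl)
  then have "set xs \<inter> set (map f ys) = {}"
    by auto
  then have "DS (n + n') s (xs @ map f ys)"
    using DS_append[OF xs(1) DS_map[OF ys(1) inj]] assms(1) by simp
  moreover have "partitionable_into_blocks (m + m') (xs @ map f ys)"
    by (intro partitionable_append xs(2) partitionable_map ys(2) inj)
  ultimately have "length (xs @ map f ys) \<le> ds_lambda s (n + n') (m + m')"
    by (rule ds_lambda_ge)
  then show ?thesis
    using xs(3) ys(3) by simp
qed

lemma ds_lambda_multiple:
  assumes "s \<ge> 1" "m > 0 \<or> n = 0"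
  shows "q * ds_lambda s n m \<le> ds_lambda s (q * n) (q * m)"
proof (induction q)
  case (Suc q)
  have "ds_lambda s n m + ds_lambda s (q * n) (q * m)
      \<le> ds_lambda s (n + q * n) (m + q * m)"
    using assms by (intro ds_lambda_superadditive) auto
  then show ?case
    using Suc.IH by simp
qed simp

section \<open>The lower bound\<close>

text \<open>
  The witness repeats \<open>0, \<dots>, j - 1\<close> as often as it has letters. Two consecutive copies do not
  create an adjacent repetition unless \<open>j = 1\<close>, and then there is only one copy.
\<close>

lemma ds_lambda_ge_square:
  assumes "2 * j \<le> s + 1"
  shows "j * j \<le> ds_lambda s j j"
proof -
  let ?xs = "concat (replicate j [0..<j])"
  have "set ?xs = {0..<j}"
    by (cases "j = 0") auto
  then have card: "card (set ?xs) = j"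
    by simp
  have blocks: "partitionable_into_blocks j ?xs"
    unfolding partitionable_into_blocks_def by (intro exI[of _ "replicate j [0..<j]"]) simp
  have "distinct_adj (concat (replicate i [0..<j]))" if "2 \<le> j" for i
  proof (induction i)
    case (Suc i)
    have "hd (concat (replicate i [0..<j])) = 0" if "concat (replicate i [0..<j]) \<noteq> []"
      using that \<open>2 \<le> j\<close> by (cases i) auto
    moreover have "distinct_adj [0..<j]"
      by (simp add: distinct_adj_conv_nth)
    ultimately show ?case
      using Suc that by (auto simp: distinct_adj_append_iff)
  qed simp
  moreover have "distinct_adj ?xs" if "j < 2"
    using that by (auto simp: less_2_cases_iff)
  ultimately have "distinct_adj ?xs"
    by (meson not_le)
  then have "DS j s ?xs"
    using DS_of_few_blocks[OF blocks] assms card by simp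
  then have "length ?xs \<le> ds_lambda s j j"
    using blocks by (rule ds_lambda_ge)
  then show ?thesis
    by (simp add: length_concat sum_list_replicate)
qed

text \<open>
  Up to a remainder, the letters are split into \<open>n div j\<close> groups of size \<open>j\<close>, where \<open>j\<close> is about half of \<open>min n s\<close>,
  and each group gets \<open>j\<close> blocks of its own. Since \<open>j \<le> n\<close>, the groups use up at least half of the
  letters.
\<close>

lemma ds_lambda_ge_min:
  assumes "s \<ge> 1"
  shows "n * min n s \<le> 4 * ds_lambda s n n"
proof (cases "n = 0")
  case False
  define j where "j = min n ((s + 1) div 2)"
  define q where "q = n div j"
  have j: "0 < j" "j \<le> n" "2 * j \<le> s + 1" "min n s \<le> 2 * j"
    using assms False by (auto simp: j_def)
  have n: "n = q * j + n mod j"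
    by (simp add: q_def)
  have "n mod j < j"
    using j(1) by simp
  moreover have "j \<le> q * j"
    using j(1,2) by (simp add: q_def div_greater_zero_iff Suc_leI)
  ultimately have "n \<le> 2 * (q * j)"
    using n by linarith
  then have "n * min n s \<le> (2 * (q * j)) * (2 * j)"
    using j(4) by (rule mult_mono) auto
  also have "\<dots> = 4 * (q * (j * j))"
    by simp
  also have "\<dots> \<le> 4 * (q * ds_lambda s j j)"
    using ds_lambda_ge_square[OF j(3)] by simp
  also have "\<dots> \<le> 4 * ds_lambda s (q * j) (q * j)"
    using ds_lambda_multiple[OF assms, of j j q] j(1) by simp
  also have "\<dots> \<le> 4 * ds_lambda s n n"
    using ds_lambda_superadditive[OF assms, of "q * j" "q * j" "n mod j" "n mod j"] n neq0_conv
    by fastforce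
  finally show ?thesis .
qed simp

section \<open>Growth\<close>

lemma eventually_powr_ge:
  assumes "\<delta> > 0" "c > 0"
  shows "\<forall>\<^sub>F n in sequentially. real n powr \<delta> \<ge> c"
proof -
  have "\<forall>\<^sub>F n in sequentially. real n \<ge> c powr (1 / \<delta>)"
    using filterlim_real_sequentially by (simp add: filterlim_at_top)
  then show ?thesis
  proof eventually_elim
    case (elim n)
    have "c = (c powr (1 / \<delta>)) powr \<delta>"
      using assms by (simp add: powr_powr)
    also have "\<dots> \<le> real n powr \<delta>"
      using elim assms by (intro powr_mono2) auto
    finally show ?case .
  qed
qed

theorem corollary3p2:
  fixes s :: "nat \<Rightarrow> nat"
  assumes "\<And>n. n \<ge> 1 \<Longrightarrow> s n \<ge> 1"
  shows "Omega_power_minus_o1 2 (\<lambda>n. real (ds_lambda (s n) n n)) \<longleftrightarrow>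
         Omega_power_minus_o1 1 (\<lambda>n. real (s n))"
proof
  assume large: "Omega_power_minus_o1 2 (\<lambda>n. real (ds_lambda (s n) n n))"
  show "Omega_power_minus_o1 1 (\<lambda>n. real (s n))"
    unfolding Omega_power_minus_o1_def
  proof (intro allI impI)
    fix \<epsilon> :: real
    assume "\<epsilon> > 0"
    then have "\<forall>\<^sub>F n in sequentially. real (ds_lambda (s n) n n) \<ge> real n powr (2 - \<epsilon> / 4)"
      using large unfolding Omega_power_minus_o1_def by (metis divide_pos_pos zero_less_numeral)
    moreover have "\<forall>\<^sub>F n in sequentially. real n powr (\<epsilon> / 2) \<ge> 3"
      using \<open>\<epsilon> > 0\<close> by (intro eventually_powr_ge) simp_all
    ultimately show "\<forall>\<^sub>F n in sequentially. real (s n) \<ge> real n powr (1 - \<epsilon>)"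
      using eventually_ge_at_top[of 1]
    proof eventually_elim
      case (elim n)
      let ?x = "real n"
      \<comment> \<open>Both sides carry the factor \<open>n\<^sup>3\<close> of the upper bound, which cancels at the end. Squaring
        doubles the loss \<open>\<epsilon> / 4\<close> in the exponent, and the remaining \<open>\<epsilon> / 2\<close> pays for the constant.\<close>
      have "?x powr 3 * (3 * ?x powr (1 - \<epsilon>)) \<le> ?x powr 3 * (?x powr (\<epsilon> / 2) * ?x powr (1 - \<epsilon>))"
        using elim(2) by (intro mult_left_mono mult_right_mono) auto
      also have "\<dots> = (?x powr (2 - \<epsilon> / 4))\<^sup>2"
        by (simp only: power2_eq_square powr_add[symmetric])
          (rule arg_cong[of _ _ "(powr) ?x"], simp)
      also have "\<dots> \<le> (real (ds_lambda (s n) n n))\<^sup>2"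
        using elim(1) by (intro power_mono) auto
      also have "\<dots> \<le> real (3 * n ^ 3 * s n)"
        using of_nat_mono[OF ds_lambda_squared_le[OF assms[OF elim(3)], of n], where 'a = real]
        by simp
      also have "\<dots> = ?x powr 3 * (3 * real (s n))"
        using elim(3) by simp
      finally show ?case
        using elim(3) by simp
    qed
  qed
next
  assume large: "Omega_power_minus_o1 1 (\<lambda>n. real (s n))"
  show "Omega_power_minus_o1 2 (\<lambda>n. real (ds_lambda (s n) n n))"
    unfolding Omega_power_minus_o1_def
  proof (intro allI impI)
    fix \<epsilon> :: real
    assume "\<epsilon> > 0"
    then have "\<forall>\<^sub>F n in sequentially. real (s n) \<ge> real n powr (1 - \<epsilon> / 2)"
      using large unfolding Omega_power_minus_o1_def by (metis half_gt_zero)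
    moreover have "\<forall>\<^sub>F n in sequentially. real n powr (\<epsilon> / 2) \<ge> 4"
      using \<open>\<epsilon> > 0\<close> by (intro eventually_powr_ge) simp_all
    ultimately show "\<forall>\<^sub>F n in sequentially. real (ds_lambda (s n) n n) \<ge> real n powr (2 - \<epsilon>)"
      using eventually_ge_at_top[of 1]
    proof eventually_elim
      case (elim n)
      let ?x = "real n"
      have "?x powr (1 - \<epsilon> / 2) \<le> ?x powr 1"
        using elim(3) \<open>\<epsilon> > 0\<close> by (intro powr_mono) auto
      then have "?x powr (1 - \<epsilon> / 2) \<le> real (min n (s n))"
        using elim(1) by simp
      have "4 * ?x powr (2 - \<epsilon>) \<le> ?x powr (\<epsilon> / 2) * ?x powr (2 - \<epsilon>)"
        using elim(2) by (intro mult_right_mono) auto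
      also have "\<dots> = ?x powr 1 * ?x powr (1 - \<epsilon> / 2)"
        by (simp only: powr_add[symmetric]) (rule arg_cong[of _ _ "(powr) ?x"], simp)
      also have "\<dots> \<le> ?x * real (min n (s n))"
        using \<open>?x powr (1 - \<epsilon> / 2) \<le> real (min n (s n))\<close> by (simp add: mult_left_mono)
      also have "\<dots> \<le> real (4 * ds_lambda (s n) n n)"
        using of_nat_mono[OF ds_lambda_ge_min[OF assms[OF elim(3)], of n], where 'a = real]
        by simp
      finally show ?case
        by simp
    qed
  qed
qed

end
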